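(* Let $(\mathcal{M}, g, A)$ be a K\"ahler manifold with a quarter-symmetric metric $A$-connection $\overset{1}{\nabla}_XY=\overset{g}{\nabla}_XY-\pi(X)AY$ with generator $\pi$. The tensor $$\overset{2}{H}(X,Y)Z=\overset{2}{R}(X,Y)Z+\overset{2}{R}ic(AX,Z)\,AY-\overset{2}{R}ic(AY,Z)\,AX$$ is independent of the generator $\pi$; that is, for any two 1-forms $\pi,\tilde\pi$ on $\mathcal{M}$, the tensors $\overset{2}{H}$ constructed from $\pi$ and from $\tilde\pi$ coincide.
   Context: A K\"ahler manifold $(\mathcal{M},g,A)$ is a Riemannian manifold $(\mathcal{M},g)$ of dimension $n=2k\ge4$ with a $(1,1)$ tensor field $A$ satisfying $A^2=-I$, $g(AX,AY)=g(X,Y)$ and $\overset{g}{\nabla}A=0$, where $\overset{g}{\nabla}$ is the Levi-Civita connection. $\overset{g}{R}$ is the Riemannian curvature tensor of $g$, $\overset{g}{R}(X,Y)Z=\overset{g}{\nabla}_X\overset{g}{\nabla}_YZ-\overset{g}{\nabla}_Y\overset{g}{\nabla}_XZ-\overset{g}{\nabla}_{[X,Y]}Z$. For a 1-form $\pi$ (the generator), the curvature tensor of the second kind is $$\overset{2}{R}(X,Y)Z=\overset{g}{R}(X,Y)Z-\overset{2}{D}(X,Z)AY+\overset{2}{D}(Y,Z)AX,\qquad \overset{2}{D}(X,Y)=(\overset{g}{\nabla}_X\pi)(Y)+\pi(Y)\pi(AX).$$ Its Ricci tensor is $\overset{2}{R}ic(Y,Z)=\mathrm{Trace}\{X\mapsto\overset{2}{R}(X,Y)Z\}$.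 *)

theory Defs
  imports "HOL-Analysis.Analysis" "HOL-Library.Function_Algebras"
begin

section \<open>Smooth functions on Euclidean space\<close>

fun C_k_on :: "nat \<Rightarrow> ('a::real_normed_vector \<Rightarrow> 'b::real_normed_vector) \<Rightarrow> 'a set \<Rightarrow> bool" where
  "C_k_on 0 f S \<longleftrightarrow> continuous_on S f"
| "C_k_on (Suc k) f S \<longleftrightarrow>
     (\<forall>x\<in>S. f differentiable (at x)) \<and> (\<forall>h. C_k_on k (\<lambda>x. frechet_derivative f (at x) h) S)"

(* Only meaningful for open S. *)
definition smooth_on :: "('a::real_normed_vector \<Rightarrow> 'b::real_normed_vector) \<Rightarrow> 'a set \<Rightarrow> bool" where
  "smooth_on f S \<longleftrightarrow> (\<forall>k. C_k_on k f S)"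


section \<open>Smooth manifolds\<close>

type_synonym ('m, 'n) chart = "'m set \<times> ('m \<Rightarrow> real ^ 'n)"

(* Charts are total functions; their values off the chart domain are irrelevant. *)
record ('m, 'n::finite) manifold =
  mtop :: "'m topology"
  atlas :: "('m, 'n) chart set"

definition is_chart :: "'m topology \<Rightarrow> ('m, 'n::finite) chart \<Rightarrow> bool" where
  "is_chart T = (\<lambda>(U, \<phi>). openin T U \<and> open (\<phi> ` U) \<and>
     homeomorphic_map (subtopology T U) (top_of_set (\<phi> ` U)) \<phi>)"

definition smooth_manifold :: "('m, 'n::finite) manifold \<Rightarrow> bool" where
  "smooth_manifold M \<longleftrightarrow>
     Hausdorff_space (mtop M) \<and> second_countable (mtop M) \<and>
     (\<forall>c\<in>atlas M. is_chart (mtop M) c) \<and>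
     (\<Union>(U, \<phi>)\<in>atlas M. U) = topspace (mtop M) \<and>
     (\<forall>(U, \<phi>)\<in>atlas M. \<forall>(V, \<psi>)\<in>atlas M. smooth_on (\<psi> \<circ> inv_into U \<phi>) (\<phi> ` (U \<inter> V)))"

definition smooth_functions :: "('m, 'n::finite) manifold \<Rightarrow> 'm set \<Rightarrow> ('m \<Rightarrow> real) set" where
  "smooth_functions M W = {f. \<forall>(U, \<phi>)\<in>atlas M. smooth_on (f \<circ> inv_into U \<phi>) (\<phi> ` (U \<inter> W))}"

definition smooth_near :: "('m, 'n::finite) manifold \<Rightarrow> 'm \<Rightarrow> ('m \<Rightarrow> real) \<Rightarrow> bool" where
  "smooth_near M p f \<longleftrightarrow> (\<exists>W. openin (mtop M) W \<and> p \<in> W \<and> f \<in> smooth_functions M W)"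


section \<open>Tangent vectors and vector fields\<close>

(* A tangent vector at p is a directional derivative, acting on the functions smooth near p;
   it is set to 0 on all other functions, so that equality of operators is equality of tangent
   vectors. Vector space operations are the pointwise ones of Function_Algebras. *)
type_synonym 'm tvec = "('m \<Rightarrow> real) \<Rightarrow> real"
type_synonym 'm vfield = "'m \<Rightarrow> 'm tvec"

fun chart_vec :: "('m, 'n::finite) manifold \<Rightarrow> ('m, 'n) chart \<Rightarrow> 'm \<Rightarrow> real ^ 'n \<Rightarrow> 'm tvec" where
  "chart_vec M (U, \<phi>) p h =
     (\<lambda>f. if smooth_near M p f then frechet_derivative (f \<circ> inv_into U \<phi>) (at (\<phi> p)) h else 0)"

definition tangent_space :: "('m, 'n::finite) manifold \<Rightarrow> 'm \<Rightarrow> 'm tvec set" where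
  "tangent_space M p = {v. \<exists>c\<in>atlas M. p \<in> fst c \<and> (\<exists>h. v = chart_vec M c p h)}"

definition vscale :: "real \<Rightarrow> 'm tvec \<Rightarrow> 'm tvec" where
  "vscale a v = (\<lambda>f. a * v f)"

definition fscale :: "('m \<Rightarrow> real) \<Rightarrow> 'm vfield \<Rightarrow> 'm vfield" (infixr "\<odot>" 75) where
  "u \<odot> X = (\<lambda>p. vscale (u p) (X p))"

definition along :: "'m vfield \<Rightarrow> ('m \<Rightarrow> real) \<Rightarrow> ('m \<Rightarrow> real)" where
  "along X f = (\<lambda>p. X p f)"

(* Smooth vector fields on an open set U, as total functions with irrelevant values off U. *)
definition vector_fields :: "('m, 'n::finite) manifold \<Rightarrow> 'm set \<Rightarrow> 'm vfield set" where
  "vector_fields M U = {X. (\<forall>p\<in>U. X p \<in> tangent_space M p) \<and>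
     (\<forall>W f. openin (mtop M) W \<longrightarrow> W \<subseteq> U \<longrightarrow> f \<in> smooth_functions M W \<longrightarrow>
        along X f \<in> smooth_functions M W)}"

definition lie_bracket :: "('m, 'n::finite) manifold \<Rightarrow> 'm vfield \<Rightarrow> 'm vfield \<Rightarrow> 'm vfield" where
  "lie_bracket M X Y =
     (\<lambda>p f. if smooth_near M p f then X p (along Y f) - Y p (along X f) else 0)"


section \<open>Tensor fields\<close>

type_synonym 'm form = "'m \<Rightarrow> 'm tvec \<Rightarrow> real"
type_synonym 'm endo = "'m \<Rightarrow> 'm tvec \<Rightarrow> 'm tvec"
type_synonym 'm bilin = "'m \<Rightarrow> 'm tvec \<Rightarrow> 'm tvec \<Rightarrow> real"

definition form_app :: "'m form \<Rightarrow> 'm vfield \<Rightarrow> ('m \<Rightarrow> real)" where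
  "form_app \<pi> X = (\<lambda>p. \<pi> p (X p))"

definition endo_app :: "'m endo \<Rightarrow> 'm vfield \<Rightarrow> 'm vfield" where
  "endo_app A X = (\<lambda>p. A p (X p))"

definition bilin_app :: "'m bilin \<Rightarrow> 'm vfield \<Rightarrow> 'm vfield \<Rightarrow> ('m \<Rightarrow> real)" where
  "bilin_app g X Y = (\<lambda>p. g p (X p) (Y p))"

definition one_form :: "('m, 'n::finite) manifold \<Rightarrow> 'm form \<Rightarrow> bool" where
  "one_form M \<pi> \<longleftrightarrow>
     (\<forall>p\<in>topspace (mtop M). \<forall>u\<in>tangent_space M p. \<forall>v\<in>tangent_space M p. \<forall>a.
        \<pi> p (u + v) = \<pi> p u + \<pi> p v \<and> \<pi> p (vscale a u) = a * \<pi> p u) \<and>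
     (\<forall>U X. openin (mtop M) U \<longrightarrow> X \<in> vector_fields M U \<longrightarrow> form_app \<pi> X \<in> smooth_functions M U)"

definition endo_field :: "('m, 'n::finite) manifold \<Rightarrow> 'm endo \<Rightarrow> bool" where
  "endo_field M A \<longleftrightarrow>
     (\<forall>p\<in>topspace (mtop M). \<forall>u\<in>tangent_space M p. \<forall>v\<in>tangent_space M p. \<forall>a.
        A p u \<in> tangent_space M p \<and>
        A p (u + v) = A p u + A p v \<and> A p (vscale a u) = vscale a (A p u)) \<and>
     (\<forall>U X. openin (mtop M) U \<longrightarrow> X \<in> vector_fields M U \<longrightarrow> endo_app A X \<in> vector_fields M U)"

definition riemannian_metric :: "('m, 'n::finite) manifold \<Rightarrow> 'm bilin \<Rightarrow> bool" where
  "riemannian_metric M g \<longleftrightarrow>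
     (\<forall>p\<in>topspace (mtop M).
        \<forall>u\<in>tangent_space M p. \<forall>v\<in>tangent_space M p. \<forall>w\<in>tangent_space M p. \<forall>a.
        g p u v = g p v u \<and>
        g p (u + v) w = g p u w + g p v w \<and> g p (vscale a u) w = a * g p u w \<and>
        (u \<noteq> 0 \<longrightarrow> g p u u > 0)) \<and>
     (\<forall>U X Y. openin (mtop M) U \<longrightarrow> X \<in> vector_fields M U \<longrightarrow> Y \<in> vector_fields M U \<longrightarrow>
        bilin_app g X Y \<in> smooth_functions M U)"


section \<open>The Levi-Civita connection\<close>

type_synonym 'm connection = "'m vfield \<Rightarrow> 'm vfield \<Rightarrow> 'm vfield"

(* Connections act on vector fields over arbitrary open sets. Compatibility with restriction is
   automatic: the indicator of U is smooth on U, so the C^infinity-linearity and Leibniz clauses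
   force the value at p to depend only on the fields near p. *)
definition affine_connection :: "('m, 'n::finite) manifold \<Rightarrow> 'm connection \<Rightarrow> bool" where
  "affine_connection M nabla \<longleftrightarrow>
     (\<forall>U. openin (mtop M) U \<longrightarrow>
       (\<forall>X\<in>vector_fields M U. \<forall>Y\<in>vector_fields M U. nabla X Y \<in> vector_fields M U) \<and>
       (\<forall>X\<in>vector_fields M U. \<forall>Y\<in>vector_fields M U. \<forall>Z\<in>vector_fields M U.
        \<forall>f\<in>smooth_functions M U. \<forall>p\<in>U.
          nabla (X + Y) Z p = nabla X Z p + nabla Y Z p \<and>
          nabla (f \<odot> X) Z p = (f \<odot> nabla X Z) p \<and>
          nabla X (Y + Z) p = nabla X Y p + nabla X Z p \<and>
          nabla X (f \<odot> Y) p = (along X f \<odot> Y) p + (f \<odot> nabla X Y) p))"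

definition levi_civita :: "('m, 'n::finite) manifold \<Rightarrow> 'm bilin \<Rightarrow> 'm connection \<Rightarrow> bool" where
  "levi_civita M g nabla \<longleftrightarrow> affine_connection M nabla \<and>
     (\<forall>U. openin (mtop M) U \<longrightarrow>
       (\<forall>X\<in>vector_fields M U. \<forall>Y\<in>vector_fields M U. \<forall>Z\<in>vector_fields M U. \<forall>p\<in>U.
          nabla X Y p - nabla Y X p = lie_bracket M X Y p \<and>
          along X (bilin_app g Y Z) p =
            bilin_app g (nabla X Y) Z p + bilin_app g Y (nabla X Z) p))"

definition cov_deriv_form :: "'m connection \<Rightarrow> 'm form \<Rightarrow> 'm vfield \<Rightarrow> 'm vfield \<Rightarrow> ('m \<Rightarrow> real)" where
  "cov_deriv_form nabla \<pi> X Y = along X (form_app \<pi> Y) - form_app \<pi> (nabla X Y)"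

definition cov_deriv_endo :: "'m connection \<Rightarrow> 'm endo \<Rightarrow> 'm vfield \<Rightarrow> 'm vfield \<Rightarrow> 'm vfield" where
  "cov_deriv_endo nabla A X Y = nabla X (endo_app A Y) - endo_app A (nabla X Y)"

definition curvature ::
    "('m, 'n::finite) manifold \<Rightarrow> 'm connection \<Rightarrow> 'm vfield \<Rightarrow> 'm vfield \<Rightarrow> 'm vfield \<Rightarrow> 'm vfield" where
  "curvature M nabla X Y Z =
     nabla X (nabla Y Z) - nabla Y (nabla X Z) - nabla (lie_bracket M X Y) Z"


section \<open>Kaehler manifolds\<close>

(* nabla is the (unique) Levi-Civita connection of g. *)
definition kahler_manifold ::
    "('m, 'n::finite) manifold \<Rightarrow> 'm bilin \<Rightarrow> 'm endo \<Rightarrow> 'm connection \<Rightarrow> bool" where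
  "kahler_manifold M g A nabla \<longleftrightarrow>
     even CARD('n) \<and> CARD('n) \<ge> 4 \<and> smooth_manifold M \<and>
     riemannian_metric M g \<and> endo_field M A \<and> levi_civita M g nabla \<and>
     (\<forall>p\<in>topspace (mtop M). \<forall>u\<in>tangent_space M p. A p (A p u) = - u) \<and>
     (\<forall>p\<in>topspace (mtop M). \<forall>u\<in>tangent_space M p. \<forall>v\<in>tangent_space M p.
        g p (A p u) (A p v) = g p u v) \<and>
     (\<forall>U. openin (mtop M) U \<longrightarrow> (\<forall>X\<in>vector_fields M U. \<forall>Y\<in>vector_fields M U. \<forall>p\<in>U.
        cov_deriv_endo nabla A X Y p = 0))"

definition quarter_symmetric_metric_A_connection ::
    "('m, 'n::finite) manifold \<Rightarrow> 'm endo \<Rightarrow> 'm connection \<Rightarrow> 'm form \<Rightarrow> 'm connection \<Rightarrow> bool" where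
  "quarter_symmetric_metric_A_connection M A nabla \<pi> nabla1 \<longleftrightarrow>
     (\<forall>U. openin (mtop M) U \<longrightarrow> (\<forall>X\<in>vector_fields M U. \<forall>Y\<in>vector_fields M U. \<forall>p\<in>U.
        nabla1 X Y p = (nabla X Y - form_app \<pi> X \<odot> endo_app A Y) p))"


section \<open>Trace, and the tensors of the second kind\<close>

fun coord_field :: "('m, 'n::finite) manifold \<Rightarrow> ('m, 'n) chart \<Rightarrow> 'n \<Rightarrow> 'm vfield" where
  "coord_field M (U, \<phi>) i = (\<lambda>p. if p \<in> U then chart_vec M (U, \<phi>) p (axis i 1) else 0)"

definition chart_at :: "('m, 'n::finite) manifold \<Rightarrow> 'm \<Rightarrow> ('m, 'n) chart" where
  "chart_at M p = (SOME c. c \<in> atlas M \<and> p \<in> fst c)"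

(* The trace at p of a C^infinity-linear operator T on vector fields: the sum over i of
   dx_i (T (d/dx_i)) in a coordinate frame around p, which for such T does not depend on the
   chart. The i-th component of a tangent vector v is v applied to the i-th coordinate function. *)
definition trace_field :: "('m, 'n::finite) manifold \<Rightarrow> ('m vfield \<Rightarrow> 'm vfield) \<Rightarrow> ('m \<Rightarrow> real)" where
  "trace_field M T = (\<lambda>p. let c = chart_at M p in
     \<Sum>i\<in>UNIV. T (coord_field M c i) p (\<lambda>q. snd c q $ i))"

definition D2 :: "'m endo \<Rightarrow> 'm connection \<Rightarrow> 'm form \<Rightarrow> 'm vfield \<Rightarrow> 'm vfield \<Rightarrow> ('m \<Rightarrow> real)" where
  "D2 A nabla \<pi> X Y =
     cov_deriv_form nabla \<pi> X Y + form_app \<pi> Y * form_app \<pi> (endo_app A X)"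

definition R2 :: "('m, 'n::finite) manifold \<Rightarrow> 'm endo \<Rightarrow> 'm connection \<Rightarrow> 'm form \<Rightarrow>
    'm vfield \<Rightarrow> 'm vfield \<Rightarrow> 'm vfield \<Rightarrow> 'm vfield" where
  "R2 M A nabla \<pi> X Y Z =
     curvature M nabla X Y Z
     - D2 A nabla \<pi> X Z \<odot> endo_app A Y + D2 A nabla \<pi> Y Z \<odot> endo_app A X"

definition Ric2 :: "('m, 'n::finite) manifold \<Rightarrow> 'm endo \<Rightarrow> 'm connection \<Rightarrow> 'm form \<Rightarrow>
    'm vfield \<Rightarrow> 'm vfield \<Rightarrow> ('m \<Rightarrow> real)" where
  "Ric2 M A nabla \<pi> Y Z = trace_field M (\<lambda>X. R2 M A nabla \<pi> X Y Z)"

definition H2 :: "('m, 'n::finite) manifold \<Rightarrow> 'm endo \<Rightarrow> 'm connection \<Rightarrow> 'm form \<Rightarrow>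
    'm vfield \<Rightarrow> 'm vfield \<Rightarrow> 'm vfield \<Rightarrow> 'm vfield" where
  "H2 M A nabla \<pi> X Y Z =
     R2 M A nabla \<pi> X Y Z
     + Ric2 M A nabla \<pi> (endo_app A X) Z \<odot> endo_app A Y
     - Ric2 M A nabla \<pi> (endo_app A Y) Z \<odot> endo_app A X"

end

theory Submission
  imports Defs
begin

text \<open>Put \<open>E = D\<^sub>\<pi> - D\<^sub>\<pi>'\<close>, the difference of the two \<open>D2\<close> tensors. The curvature of \<open>nabla\<close> cancels in the
  difference of the tensors \<open>R2\<close>, which is \<open>- E(X,Z) AY + E(Y,Z) AX\<close>. Since \<open>E\<close> is tensorial and
  \<open>tr A = 0\<close>, the difference of the Ricci tensors at \<open>(Y,Z)\<close> is \<open>- E(AY,Z)\<close>, hence \<open>E(Y,Z)\<close> at \<open>(AY,Z)\<close>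
  because \<open>A\<^sup>2 = -I\<close>, and everything cancels in the difference of the tensors \<open>H2\<close>.\<close>

section \<open>Calculus of $C^k$ functions\<close>

lemma C_k_on_subset: "C_k_on k f S \<Longrightarrow> T \<subseteq> S \<Longrightarrow> C_k_on k f T"
  by (induction k arbitrary: f) (auto intro: continuous_on_subset)

text \<open>Derivatives are taken with the full filter \<open>at x\<close>, so pointwise agreement
  on a set says nothing about them unless the set is a neighbourhood of \<open>x\<close>; hence
  \<open>S\<close> is open. The agreement then passes to the directional derivatives, and the
  induction continues with those.\<close>

lemma C_k_on_cong:
  assumes "open S" and "\<And>x. x \<in> S \<Longrightarrow> f x = g x" and "C_k_on k f S"
  shows "C_k_on k g S"
  using assms(2,3)
proof (induction k arbitrary: f g)
  case 0
  then show ?case using continuous_on_cong[of S S f g] by simp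
next
  case (Suc k)
  have der: "(g has_derivative frechet_derivative f (at x)) (at x)" if "x \<in> S" for x
  proof (rule has_derivative_transform_within_open[OF _ \<open>open S\<close> that])
    show "(f has_derivative frechet_derivative f (at x)) (at x)"
      using Suc.prems(2) that by (simp add: frechet_derivative_works)
  qed (use Suc.prems(1) in simp)
  show ?case
    unfolding C_k_on.simps
  proof (intro conjI ballI allI)
    fix x assume "x \<in> S"
    then show "g differentiable at x" using der differentiable_def by blast
  next
    fix h
    have "C_k_on k (\<lambda>x. frechet_derivative f (at x) h) S" using Suc.prems(2) by simp
    then show "C_k_on k (\<lambda>x. frechet_derivative g (at x) h) S"
      by (rule Suc.IH[rotated]) (simp add: frechet_derivative_at[OF der])
  qed
qed

text \<open>\<open>C_k_on\<close> speaks of the chosen \<open>frechet_derivative\<close>; by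
  uniqueness of derivatives any explicit \<open>f'\<close> may stand in for it.\<close>

lemma C_k_on_SucI:
  assumes "open S" and "\<And>x. x \<in> S \<Longrightarrow> (f has_derivative f' x) (at x)"
    and "\<And>h. C_k_on k (\<lambda>x. f' x h) S"
  shows "C_k_on (Suc k) f S"
  unfolding C_k_on.simps
proof (intro conjI ballI allI)
  fix x assume "x \<in> S"
  then show "f differentiable at x" using assms(2) differentiable_def by blast
next
  fix h
  show "C_k_on k (\<lambda>x. frechet_derivative f (at x) h) S"
    by (rule C_k_on_cong[OF assms(1) _ assms(3)]) (simp add: frechet_derivative_at[OF assms(2)])
qed

lemma C_k_on_Suc_has_derivative:
  assumes "C_k_on (Suc k) f S" and "x \<in> S"
  shows "(f has_derivative frechet_derivative f (at x)) (at x)"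
  using assms by (simp add: frechet_derivative_works)

lemma C_k_on_SucD: "C_k_on (Suc k) f S \<Longrightarrow> C_k_on k f S"
proof (induction k arbitrary: f)
  case 0
  then show ?case
    by (auto intro!: continuous_at_imp_continuous_on differentiable_imp_continuous_within)
next
  case (Suc k)
  show ?case
    \<comment> \<open>Goal and premise are unfolded by exactly one derivative each, so that the
      induction hypothesis fits the directional derivatives.\<close>
    unfolding C_k_on.simps(2)[of k]
    using Suc.prems Suc.IH by (auto simp del: C_k_on.simps simp: C_k_on.simps(2)[of "Suc k"])
qed

lemma C_k_on_const: "open S \<Longrightarrow> C_k_on k (\<lambda>x. c) S"
proof (induction k arbitrary: c)
  case (Suc k)
  show ?case
    by (rule C_k_on_SucI[where f' = "\<lambda>x h. 0"]) (use Suc in auto)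
qed simp

lemma C_k_on_add:
  assumes "open S" and "C_k_on k f S" and "C_k_on k g S"
  shows "C_k_on k (\<lambda>x. f x + g x) S"
  using assms(2,3)
proof (induction k arbitrary: f g)
  case 0
  then show ?case by (simp add: continuous_on_add)
next
  case (Suc k)
  show ?case
    by (rule C_k_on_SucI[OF \<open>open S\<close> has_derivative_add
          [OF C_k_on_Suc_has_derivative[OF Suc.prems(1)] C_k_on_Suc_has_derivative[OF Suc.prems(2)]]])
       (use Suc in simp_all)
qed

lemma C_k_on_sum:
  assumes "open S" and "finite I" and "\<And>i. i \<in> I \<Longrightarrow> C_k_on k (f i) S"
  shows "C_k_on k (\<lambda>x. \<Sum>i\<in>I. f i x) S"
  using assms(2,3)
  by (induction I rule: finite_induct) (simp_all add: C_k_on_const C_k_on_add assms(1))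

lemma C_k_on_mult:
  fixes f g :: "'a::real_normed_vector \<Rightarrow> 'b::real_normed_algebra"
  assumes "open S" and "C_k_on k f S" and "C_k_on k g S"
  shows "C_k_on k (\<lambda>x. f x * g x) S"
  using assms(2,3)
proof (induction k arbitrary: f g)
  case 0
  then show ?case by (simp add: continuous_on_mult)
next
  case (Suc k)
  show ?case
  proof (rule C_k_on_SucI[OF \<open>open S\<close> has_derivative_mult
          [OF C_k_on_Suc_has_derivative[OF Suc.prems(1)] C_k_on_Suc_has_derivative[OF Suc.prems(2)]]])
    fix h
    show "C_k_on k (\<lambda>x. f x * frechet_derivative g (at x) h + frechet_derivative f (at x) h * g x) S"
      \<comment> \<open>Each summand of the product rule keeps one factor undifferentiated; its
        order has to be lowered from \<open>Suc k\<close> to \<open>k\<close>.\<close>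
      using Suc.prems C_k_on_SucD[OF Suc.prems(1)] C_k_on_SucD[OF Suc.prems(2)]
      by (intro C_k_on_add Suc.IH \<open>open S\<close>) simp_all
  qed
qed

lemma C_k_on_bounded_linear:
  assumes L: "bounded_linear L" and "open S" and "C_k_on k f S"
  shows "C_k_on k (\<lambda>x. L (f x)) S"
  using assms(3)
proof (induction k arbitrary: f)
  case 0
  then show ?case using L by (simp add: bounded_linear.continuous_on)
next
  case (Suc k)
  show ?case
    by (rule C_k_on_SucI[OF \<open>open S\<close> bounded_linear.has_derivative
          [OF L C_k_on_Suc_has_derivative[OF Suc.prems]]])
       (use Suc in simp_all)
qed

lemma C_k_on_ident: "open S \<Longrightarrow> C_k_on k (\<lambda>x. x) S"
proof (cases k)
  case (Suc j)
  assume "open S"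
  then show ?thesis
    unfolding Suc by (rule C_k_on_SucI[where f' = "\<lambda>x h. h"]) (auto intro: C_k_on_const[OF \<open>open S\<close>])
qed simp

text \<open>The chain rule yields a varying linear map applied to a varying vector. Expanding the
  vector in \<open>Basis\<close> turns this into a finite sum of products, which the sum and product
  rules handle. The codomain is a unital algebra so that the scalar coefficients can enter through
  \<open>of_real\<close>.\<close>

lemma C_k_on_compose:
  fixes f :: "'b::euclidean_space \<Rightarrow> 'c::real_normed_algebra_1"
  assumes S: "open S" and "g ` S \<subseteq> T" and "C_k_on k f T" and "C_k_on k g S"
  shows "C_k_on k (\<lambda>x. f (g x)) S"
  using assms(3,4)
proof (induction k arbitrary: f)
  case 0
  then show ?case using assms(2) continuous_on_compose2[of T f S g] by simp
next
  case (Suc k)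
  have gS: "g x \<in> T" if "x \<in> S" for x using assms(2) that by auto
  have der: "((\<lambda>x. f (g x)) has_derivative
      (\<lambda>h. frechet_derivative f (at (g x)) (frechet_derivative g (at x) h))) (at x)" if "x \<in> S" for x
    by (rule has_derivative_compose[OF C_k_on_Suc_has_derivative[OF Suc.prems(2) that]
          C_k_on_Suc_has_derivative[OF Suc.prems(1) gS[OF that]]])
  have expand: "frechet_derivative f (at (g x)) v
      = (\<Sum>b\<in>Basis. of_real (v \<bullet> b) * frechet_derivative f (at (g x)) b)" if "x \<in> S" for x v
  proof -
    have lin: "linear (frechet_derivative f (at (g x)))"
      using C_k_on_Suc_has_derivative[OF Suc.prems(1) gS[OF that]] has_derivative_linear by blast
    show ?thesis
      by (subst (1) euclidean_representation[of v, symmetric])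
         (simp add: linear_sum[OF lin] linear_cmul[OF lin] scaleR_conv_of_real)
  qed
  show ?case
  proof (rule C_k_on_SucI[OF S der])
    fix h
    have "C_k_on k (\<lambda>x. of_real (frechet_derivative g (at x) h \<bullet> b) :: 'c) S" for b
      by (rule C_k_on_bounded_linear[OF bounded_linear_compose[OF bounded_linear_of_real
              bounded_linear_inner_left] S])
         (use Suc.prems(2) in simp)
    \<comment> \<open>The outer function changes to a directional derivative of \<open>f\<close>,
      while \<open>g\<close> stays the same with its order lowered by one.\<close>
    moreover have "C_k_on k (\<lambda>x. frechet_derivative f (at (g x)) b) S" for b
      by (rule Suc.IH[of "\<lambda>y. frechet_derivative f (at y) b"])
         (use Suc.prems(1) C_k_on_SucD[OF Suc.prems(2)] in simp_all)
    ultimately have "C_k_on k (\<lambda>x. \<Sum>b\<in>Basis. of_real (frechet_derivative g (at x) h \<bullet> b)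
        * frechet_derivative f (at (g x)) b) S"
      by (intro C_k_on_sum C_k_on_mult S) auto
    then show "C_k_on k (\<lambda>x. frechet_derivative f (at (g x)) (frechet_derivative g (at x) h)) S"
      by (rule C_k_on_cong[OF S, rotated]) (simp add: expand[symmetric])
  qed auto
qed

lemma smooth_on_cong:
  "open S \<Longrightarrow> (\<And>x. x \<in> S \<Longrightarrow> f x = g x) \<Longrightarrow> smooth_on f S \<Longrightarrow> smooth_on g S"
  unfolding smooth_on_def using C_k_on_cong by blast

lemma smooth_on_subset: "smooth_on f S \<Longrightarrow> T \<subseteq> S \<Longrightarrow> smooth_on f T"
  unfolding smooth_on_def using C_k_on_subset by blast

lemma smooth_on_has_derivative:
  "smooth_on f S \<Longrightarrow> x \<in> S \<Longrightarrow> (f has_derivative frechet_derivative f (at x)) (at x)"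
  unfolding smooth_on_def by (meson C_k_on_Suc_has_derivative)

lemma smooth_on_derivative: "smooth_on f S \<Longrightarrow> smooth_on (\<lambda>x. frechet_derivative f (at x) h) S"
  unfolding smooth_on_def by (metis C_k_on.simps(2))


section \<open>Charts and smooth functions on a manifold\<close>

lemma
  assumes M: "smooth_manifold M" and c: "(V, \<phi>) \<in> atlas M"
  shows chart_inj: "inj_on \<phi> V"
    and chart_openin: "openin (mtop M) V"
    and chart_open_image: "openin (mtop M) W \<Longrightarrow> open (\<phi> ` (V \<inter> W))"
proof -
  have "is_chart (mtop M) (V, \<phi>)" using M c by (simp add: smooth_manifold_def)
  then have V: "openin (mtop M) V" "open (\<phi> ` V)"
    and h: "homeomorphic_map (subtopology (mtop M) V) (top_of_set (\<phi> ` V)) \<phi>"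
    by (auto simp: is_chart_def)
  have ts: "topspace (subtopology (mtop M) V) = V"
    using V(1) openin_subset by fastforce
  show "inj_on \<phi> V" using homeomorphic_imp_injective_map[OF h] ts by simp
  show "openin (mtop M) V" by fact
  assume "openin (mtop M) W"
  then have "openin (subtopology (mtop M) V) (V \<inter> W)"
    by (rule openin_subtopology_Int2)
  then have "openin (top_of_set (\<phi> ` V)) (\<phi> ` (V \<inter> W))"
    using homeomorphic_imp_open_map[OF h] unfolding open_map_def by blast
  then show "open (\<phi> ` (V \<inter> W))" using V(2) openin_open_trans by blast
qed

lemma chart_inv:
  assumes "smooth_manifold M" and "(V, \<phi>) \<in> atlas M" and "q \<in> V"
  shows "inv_into V \<phi> (\<phi> q) = q"
  using chart_inj[OF assms(1,2)] assms(3) by simp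

lemma chart_transition_smooth:
  assumes "smooth_manifold M" and "(V, \<phi>) \<in> atlas M" and "(V', \<psi>) \<in> atlas M"
  shows "smooth_on (\<phi> \<circ> inv_into V' \<psi>) (\<psi> ` (V' \<inter> V))"
  using assms unfolding smooth_manifold_def by fast

lemma smooth_functionsI:
  "(\<And>V \<phi>. (V, \<phi>) \<in> atlas M \<Longrightarrow> smooth_on (f \<circ> inv_into V \<phi>) (\<phi> ` (V \<inter> W))) \<Longrightarrow> f \<in> smooth_functions M W"
  unfolding smooth_functions_def by fast

lemma smooth_functionsD:
  "f \<in> smooth_functions M W \<Longrightarrow> (V, \<phi>) \<in> atlas M \<Longrightarrow> smooth_on (f \<circ> inv_into V \<phi>) (\<phi> ` (V \<inter> W))"
  unfolding smooth_functions_def by fast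

lemma smooth_functions_subset:
  assumes "f \<in> smooth_functions M U" and "W \<subseteq> U"
  shows "f \<in> smooth_functions M W"
proof (rule smooth_functionsI)
  fix V \<phi> assume "(V, \<phi>) \<in> atlas M"
  from smooth_functionsD[OF assms(1) this]
  show "smooth_on (f \<circ> inv_into V \<phi>) (\<phi> ` (V \<inter> W))"
    by (rule smooth_on_subset) (use assms(2) in blast)
qed

text \<open>Constancy is asked for on \<open>W\<close> only, so that the indicator of
  \<open>W\<close> is covered too.\<close>

lemma smooth_functions_const_on:
  assumes M: "smooth_manifold M" and W: "openin (mtop M) W" and f: "\<And>q. q \<in> W \<Longrightarrow> f q = a"
  shows "f \<in> smooth_functions M W"
proof (rule smooth_functionsI)
  fix V \<phi> assume c: "(V, \<phi>) \<in> atlas M"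
  have S: "open (\<phi> ` (V \<inter> W))" by (rule chart_open_image[OF M c W])
  then have "smooth_on (\<lambda>x. a) (\<phi> ` (V \<inter> W))" by (simp add: smooth_on_def C_k_on_const)
  then show "smooth_on (f \<circ> inv_into V \<phi>) (\<phi> ` (V \<inter> W))"
    by (rule smooth_on_cong[OF S, rotated]) (use f chart_inv[OF M c] in auto)
qed

lemma
  assumes M: "smooth_manifold M" and W: "openin (mtop M) W"
    and f: "f \<in> smooth_functions M W" and g: "g \<in> smooth_functions M W"
  shows smooth_functions_add: "f + g \<in> smooth_functions M W"
    and smooth_functions_mult: "f * g \<in> smooth_functions M W"
proof -
  show "f + g \<in> smooth_functions M W"
  proof (rule smooth_functionsI)
    fix V \<phi> assume c: "(V, \<phi>) \<in> atlas M"
    show "smooth_on ((f + g) \<circ> inv_into V \<phi>) (\<phi> ` (V \<inter> W))"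
      using smooth_functionsD[OF f c] smooth_functionsD[OF g c]
      by (auto simp: smooth_on_def o_def intro!: C_k_on_add chart_open_image[OF M c W])
  qed
  show "f * g \<in> smooth_functions M W"
  proof (rule smooth_functionsI)
    fix V \<phi> assume c: "(V, \<phi>) \<in> atlas M"
    show "smooth_on ((f * g) \<circ> inv_into V \<phi>) (\<phi> ` (V \<inter> W))"
      using smooth_functionsD[OF f c] smooth_functionsD[OF g c]
      by (auto simp: smooth_on_def o_def intro!: C_k_on_mult chart_open_image[OF M c W])
  qed
qed

text \<open>In any other chart, \<open>f\<close> is its given representative composed with a smooth
  transition map.\<close>

lemma smooth_functions_one_chart:
  fixes M :: "('m, 'n::finite) manifold"
  assumes M: "smooth_manifold M" and c: "(V, \<phi>) \<in> atlas M" and W: "openin (mtop M) W" "W \<subseteq> V"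
    and f: "smooth_on (f \<circ> inv_into V \<phi>) (\<phi> ` W)"
  shows "f \<in> smooth_functions M W"
proof (rule smooth_functionsI)
  fix V' \<psi> assume c': "(V', \<psi>) \<in> atlas M"
  let ?t = "\<phi> \<circ> inv_into V' \<psi>"
  have S: "open (\<psi> ` (V' \<inter> W))" by (rule chart_open_image[OF M c' W(1)])
  have "smooth_on ?t (\<psi> ` (V' \<inter> V))" by (rule chart_transition_smooth[OF M c c'])
  then have "smooth_on ?t (\<psi> ` (V' \<inter> W))"
    by (rule smooth_on_subset) (use W in blast)
  then have t: "C_k_on k ?t (\<psi> ` (V' \<inter> W))" for k by (simp add: smooth_on_def)
  have im: "?t ` \<psi> ` (V' \<inter> W) \<subseteq> \<phi> ` W"
  proof (intro image_subsetI)
    fix y assume "y \<in> \<psi> ` (V' \<inter> W)"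
    then obtain q where "q \<in> V'" "q \<in> W" "y = \<psi> q" by blast
    then show "?t y \<in> \<phi> ` W" using chart_inv[OF M c'] by simp
  qed
  have "smooth_on (\<lambda>x. (f \<circ> inv_into V \<phi>) (?t x)) (\<psi> ` (V' \<inter> W))"
    unfolding smooth_on_def
    by (intro allI C_k_on_compose[OF S im _ t]) (use f in \<open>simp add: smooth_on_def o_def\<close>)
  then show "smooth_on (f \<circ> inv_into V' \<psi>) (\<psi> ` (V' \<inter> W))"
  proof (rule smooth_on_cong[OF S, rotated])
    fix y assume "y \<in> \<psi> ` (V' \<inter> W)"
    then obtain q where "q \<in> V'" "q \<in> W" "y = \<psi> q" by blast
    then show "(f \<circ> inv_into V \<phi>) (?t y) = (f \<circ> inv_into V' \<psi>) y"
      using chart_inv[OF M c] chart_inv[OF M c'] W(2) by auto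
  qed
qed

lemma coordinate_function_smooth:
  assumes M: "smooth_manifold M" and c: "(V, \<phi>) \<in> atlas M"
  shows "(\<lambda>q. \<phi> q $ i) \<in> smooth_functions M V"
proof (rule smooth_functions_one_chart[OF M c chart_openin[OF M c]])
  have S: "open (\<phi> ` V)" using chart_open_image[OF M c chart_openin[OF M c]] by simp
  have "smooth_on (\<lambda>x. x $ i) (\<phi> ` V)"
    unfolding smooth_on_def
    by (intro allI C_k_on_bounded_linear[OF bounded_linear_vec_nth S C_k_on_ident[OF S]])
  then show "smooth_on ((\<lambda>q. \<phi> q $ i) \<circ> inv_into V \<phi>) (\<phi> ` V)"
    by (rule smooth_on_cong[OF S, rotated]) (use chart_inv[OF M c] in auto)
qed simp


section \<open>Tangent vectors\<close>

lemma smooth_near_has_derivative: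
  assumes "smooth_near M p f" and "(V, \<phi>) \<in> atlas M" and "p \<in> V"
  shows "((f \<circ> inv_into V \<phi>) has_derivative frechet_derivative (f \<circ> inv_into V \<phi>) (at (\<phi> p))) (at (\<phi> p))"
proof -
  obtain W where "openin (mtop M) W" "p \<in> W" "f \<in> smooth_functions M W"
    using assms(1) unfolding smooth_near_def by blast
  from smooth_functionsD[OF this(3) assms(2)]
  have "smooth_on (f \<circ> inv_into V \<phi>) (\<phi> ` (V \<inter> W))" .
  then show ?thesis
    by (rule smooth_on_has_derivative) (use \<open>p \<in> W\<close> assms(3) in blast)
qed


declare chart_vec.simps [simp del] coord_field.simps [simp del]

text \<open>This is the chain rule for the transition map when \<open>f\<close> is smooth near
  \<open>p\<close>; on all other functions both sides take the default value 0.\<close>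

lemma chart_vec_change:
  assumes M: "smooth_manifold M" and c: "(V, \<phi>) \<in> atlas M" "p \<in> V"
    and c': "(V', \<psi>) \<in> atlas M" "p \<in> V'"
  shows "chart_vec M (V', \<psi>) p h
       = chart_vec M (V, \<phi>) p (frechet_derivative (\<phi> \<circ> inv_into V' \<psi>) (at (\<psi> p)) h)"
proof (rule ext)
  fix f
  let ?t = "\<phi> \<circ> inv_into V' \<psi>"
  show "chart_vec M (V', \<psi>) p h f = chart_vec M (V, \<phi>) p (frechet_derivative ?t (at (\<psi> p)) h) f"
  proof (cases "smooth_near M p f")
    case True
    have tp: "?t (\<psi> p) = \<phi> p" using chart_inv[OF M c'(1)] c'(2) by simp
    have "(?t has_derivative frechet_derivative ?t (at (\<psi> p))) (at (\<psi> p))"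
      by (rule smooth_on_has_derivative[OF chart_transition_smooth[OF M c(1) c'(1)]]) (use c c' in blast)
    moreover have "((f \<circ> inv_into V \<phi>) has_derivative frechet_derivative (f \<circ> inv_into V \<phi>) (at (\<phi> p)))
        (at (?t (\<psi> p)))"
      unfolding tp by (rule smooth_near_has_derivative[OF True c])
    ultimately have "((\<lambda>x. (f \<circ> inv_into V \<phi>) (?t x)) has_derivative
        (\<lambda>h. frechet_derivative (f \<circ> inv_into V \<phi>) (at (\<phi> p)) (frechet_derivative ?t (at (\<psi> p)) h))) (at (\<psi> p))"
      by (rule has_derivative_compose)
    then have "((f \<circ> inv_into V' \<psi>) has_derivative
        (\<lambda>h. frechet_derivative (f \<circ> inv_into V \<phi>) (at (\<phi> p)) (frechet_derivative ?t (at (\<psi> p)) h))) (at (\<psi> p))"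
    \<comment> \<open>The composite through the other chart agrees with the representative of
      \<open>f\<close> only over the overlap of the charts, an open set around the point.\<close>
    proof (rule has_derivative_transform_within_open
            [OF _ chart_open_image[OF M c'(1) chart_openin[OF M c(1)]]])
      fix y assume "y \<in> \<psi> ` (V' \<inter> V)"
      then obtain q where "q \<in> V'" "q \<in> V" "y = \<psi> q" by blast
      then show "(f \<circ> inv_into V \<phi>) (?t y) = (f \<circ> inv_into V' \<psi>) y"
        by (simp add: chart_inv[OF M c(1)] chart_inv[OF M c'(1)])
    qed (use c c' in blast)
    from fun_cong[OF frechet_derivative_at[OF this], of h] show ?thesis using True by (simp add: chart_vec.simps)
  qed (simp add: chart_vec.simps)
qed

text \<open>The definition collects vectors from all charts around \<open>p\<close>; by the change
  of charts one chart already gives them all, so linear structure can be checked in a single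
  chart.\<close>

lemma tangent_space_chart:
  assumes M: "smooth_manifold M" and c: "(V, \<phi>) \<in> atlas M" "p \<in> V"
  shows "tangent_space M p = range (chart_vec M (V, \<phi>) p)"
proof (intro equalityI subsetI)
  fix v assume "v \<in> tangent_space M p"
  then obtain V' \<psi> h where "(V', \<psi>) \<in> atlas M" "p \<in> V'" "v = chart_vec M (V', \<psi>) p h"
    unfolding tangent_space_def by force
  with chart_vec_change[OF M c] show "v \<in> range (chart_vec M (V, \<phi>) p)" by blast
next
  fix v assume "v \<in> range (chart_vec M (V, \<phi>) p)"
  then show "v \<in> tangent_space M p"
    unfolding tangent_space_def using c by force
qed

lemma
  assumes "(V, \<phi>) \<in> atlas M" and "p \<in> V"
  shows chart_vec_add: "chart_vec M (V, \<phi>) p (h + k) = chart_vec M (V, \<phi>) p h + chart_vec M (V, \<phi>) p k"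
    and chart_vec_scaleR: "chart_vec M (V, \<phi>) p (a *\<^sub>R h) = vscale a (chart_vec M (V, \<phi>) p h)"
  using has_derivative_linear[OF smooth_near_has_derivative[OF _ assms]]
  by (auto simp: chart_vec.simps fun_eq_iff vscale_def linear_add linear_cmul)

lemma vscale_zero: "vscale 0 v = 0"
  by (simp add: vscale_def fun_eq_iff)

lemma chart_vec_sum:
  assumes "(V, \<phi>) \<in> atlas M" and "p \<in> V" and "finite I"
  shows "chart_vec M (V, \<phi>) p (\<Sum>i\<in>I. a i *\<^sub>R h i) = (\<Sum>i\<in>I. vscale (a i) (chart_vec M (V, \<phi>) p (h i)))"
  using assms(3)
proof (induction I rule: finite_induct)
  case empty
  show ?case using chart_vec_scaleR[OF assms(1,2), of 0 0] by (simp add: vscale_zero)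
next
  case (insert i I)
  then show ?case by (simp add: chart_vec_add[OF assms(1,2)] chart_vec_scaleR[OF assms(1,2)])
qed

lemma chart_vec_coordinate:
  assumes M: "smooth_manifold M" and c: "(V, \<phi>) \<in> atlas M" "p \<in> V"
  shows "chart_vec M (V, \<phi>) p h (\<lambda>q. \<phi> q $ i) = h $ i"
proof -
  \<comment> \<open>Without smoothness near \<open>p\<close> the chart vector would return its
    default 0 instead of a derivative.\<close>
  have near: "smooth_near M p (\<lambda>q. \<phi> q $ i)"
    using coordinate_function_smooth[OF M c(1)] chart_openin[OF M c(1)] c(2)
    unfolding smooth_near_def by blast
  have S: "open (\<phi> ` V)" using chart_open_image[OF M c(1) chart_openin[OF M c(1)]] by simp
  have "((\<lambda>x. x $ i) has_derivative (\<lambda>h. h $ i)) (at (\<phi> p))"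
    by (intro bounded_linear_imp_has_derivative bounded_linear_vec_nth)
  then have "(((\<lambda>q. \<phi> q $ i) \<circ> inv_into V \<phi>) has_derivative (\<lambda>h. h $ i)) (at (\<phi> p))"
    by (rule has_derivative_transform_within_open[OF _ S])
       (use c(2) in \<open>auto simp: chart_inv[OF M c(1)]\<close>)
  from fun_cong[OF frechet_derivative_at[OF this], of h] show ?thesis using near by (simp add: chart_vec.simps)
qed

text \<open>The coordinate functions act as the dual basis of the coordinate frame, so the
  coefficients are read off from \<open>v\<close> itself rather than from a chosen
  \<open>h\<close>.\<close>

lemma tangent_expansion:
  fixes M :: "('m, 'n::finite) manifold"
  assumes M: "smooth_manifold M" and c: "(V, \<phi>) \<in> atlas M" "p \<in> V" and v: "v \<in> tangent_space M p"
  shows "v = (\<Sum>i\<in>UNIV. vscale (v (\<lambda>q. \<phi> q $ i)) (coord_field M (V, \<phi>) i p))"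
proof -
  obtain h where h: "v = chart_vec M (V, \<phi>) p h" using v tangent_space_chart[OF M c] by auto
  have "h = (\<Sum>i\<in>UNIV. h $ i *\<^sub>R axis i 1)" by (simp add: basis_expansion flip: scalar_mult_eq_scaleR)
  then have "v = chart_vec M (V, \<phi>) p (\<Sum>i\<in>UNIV. h $ i *\<^sub>R axis i 1)" using h by simp
  also have "\<dots> = (\<Sum>i\<in>UNIV. vscale (h $ i) (chart_vec M (V, \<phi>) p (axis i 1)))"
    by (rule chart_vec_sum[OF c]) simp
  finally have "v = (\<Sum>i\<in>UNIV. vscale (h $ i) (coord_field M (V, \<phi>) i p))"
    using c(2) by (simp add: coord_field.simps)
  moreover have "v (\<lambda>q. \<phi> q $ i) = h $ i" for i
    unfolding h by (rule chart_vec_coordinate[OF M c])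
  ultimately show ?thesis by (simp only:)
qed

lemma
  assumes M: "smooth_manifold M" and p: "p \<in> topspace (mtop M)"
    and u: "u \<in> tangent_space M p"
  shows tangent_add: "v \<in> tangent_space M p \<Longrightarrow> u + v \<in> tangent_space M p"
    and tangent_vscale: "vscale a u \<in> tangent_space M p"
proof -
  obtain V \<phi> where c: "(V, \<phi>) \<in> atlas M" "p \<in> V"
    using M p unfolding smooth_manifold_def by blast
  show "v \<in> tangent_space M p \<Longrightarrow> u + v \<in> tangent_space M p"
    using u unfolding tangent_space_chart[OF M c]
    by (auto simp: chart_vec_add[OF c, symmetric])
  show "vscale a u \<in> tangent_space M p"
    using u unfolding tangent_space_chart[OF M c]
    by (auto simp: chart_vec_scaleR[OF c, symmetric])
qed

lemma tangent_zero:
  assumes "smooth_manifold M" and "p \<in> topspace (mtop M)"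
  shows "0 \<in> tangent_space M p"
proof -
  obtain V \<phi> where c: "(V, \<phi>) \<in> atlas M" "p \<in> V"
    using assms unfolding smooth_manifold_def by blast
  have "chart_vec M (V, \<phi>) p 0 = 0" using chart_vec_sum[OF c, of "{}"] by simp
  then show ?thesis unfolding tangent_space_chart[OF assms(1) c] by (metis rangeI)
qed

lemma tangent_sum:
  assumes "smooth_manifold M" and "p \<in> topspace (mtop M)" and "finite I"
    and "\<And>i. i \<in> I \<Longrightarrow> v i \<in> tangent_space M p"
  shows "(\<Sum>i\<in>I. vscale (a i) (v i)) \<in> tangent_space M p"
  using assms(3,4)
  by (induction I rule: finite_induct)
     (simp_all add: tangent_zero tangent_add tangent_vscale assms(1,2))

text \<open>Forms and metrics are constrained on tangent vectors only, so \<open>L\<close> is linear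
  merely on the tangent space, and each induction step must know that the partial sum lies
  there.\<close>

lemma tangent_functional_sum:
  assumes M: "smooth_manifold M" "p \<in> topspace (mtop M)" and "finite I"
    and "\<And>i. i \<in> I \<Longrightarrow> v i \<in> tangent_space M p"
    and add: "\<And>u v. u \<in> tangent_space M p \<Longrightarrow> v \<in> tangent_space M p \<Longrightarrow> L (u + v) = L u + (L v :: real)"
    and scale: "\<And>u a. u \<in> tangent_space M p \<Longrightarrow> L (vscale a u) = a * L u"
  shows "L (\<Sum>i\<in>I. vscale (a i) (v i)) = (\<Sum>i\<in>I. a i * L (v i))"
  using assms(3,4)
proof (induction I rule: finite_induct)
  case empty
  show ?case unfolding sum.empty using scale[OF tangent_zero[OF M], of 0] by (simp only: vscale_zero)
next
  case (insert i I)
  then show ?case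
    unfolding sum.insert[OF insert.hyps]
    by (subst add) (simp_all add: scale tangent_sum tangent_vscale M)
qed


section \<open>Vector fields and connections in a coordinate frame\<close>

lemma vector_fields_tangent: "X \<in> vector_fields M U \<Longrightarrow> p \<in> U \<Longrightarrow> X p \<in> tangent_space M p"
  by (simp add: vector_fields_def)

lemma vector_fields_along:
  "X \<in> vector_fields M U \<Longrightarrow> openin (mtop M) W \<Longrightarrow> W \<subseteq> U \<Longrightarrow> f \<in> smooth_functions M W
    \<Longrightarrow> along X f \<in> smooth_functions M W"
  by (simp add: vector_fields_def)

lemma vector_fields_subset: "X \<in> vector_fields M U \<Longrightarrow> W \<subseteq> U \<Longrightarrow> X \<in> vector_fields M W"
  unfolding vector_fields_def by blast

lemma along_add: "along (X + Y) f = along X f + along Y f"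
  by (simp add: along_def fun_eq_iff)

lemma along_fscale: "along (u \<odot> X) f = u * along X f"
  by (simp add: along_def fscale_def vscale_def fun_eq_iff)

lemma fscale_zero: "0 \<odot> X = 0"
  by (simp add: fscale_def vscale_def fun_eq_iff)

lemma sum_fscale_apply: "(\<Sum>i\<in>I. u i \<odot> X i) q = (\<Sum>i\<in>I. vscale (u i q) (X i q))"
  by (induction I rule: infinite_finite_induct) (simp_all add: fscale_def)

lemma openin_in_topspace: "openin T U \<Longrightarrow> p \<in> U \<Longrightarrow> p \<in> topspace T"
  using openin_subset by blast

lemma vector_fields_add:
  assumes M: "smooth_manifold M" and U: "openin (mtop M) U"
    and "X \<in> vector_fields M U" and "Y \<in> vector_fields M U"
  shows "X + Y \<in> vector_fields M U"
  using assms unfolding vector_fields_def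
  by (simp add: along_add smooth_functions_add tangent_add openin_in_topspace[OF U])

lemma vector_fields_fscale:
  assumes M: "smooth_manifold M" and U: "openin (mtop M) U"
    and u: "u \<in> smooth_functions M U" and X: "X \<in> vector_fields M U"
  shows "u \<odot> X \<in> vector_fields M U"
  unfolding vector_fields_def
proof (intro CollectI conjI ballI allI impI)
  fix q assume "q \<in> U"
  then show "(u \<odot> X) q \<in> tangent_space M q"
    using tangent_vscale[OF M openin_in_topspace[OF U]] vector_fields_tangent[OF X]
    by (simp add: fscale_def)
next
  fix W f assume "openin (mtop M) W" "W \<subseteq> U" "f \<in> smooth_functions M W"
  then show "along (u \<odot> X) f \<in> smooth_functions M W"
    unfolding along_fscale
    by (intro smooth_functions_mult M vector_fields_along[OF X] smooth_functions_subset[OF u])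
qed

lemma vector_fields_zero:
  assumes M: "smooth_manifold M" and U: "openin (mtop M) U"
  shows "0 \<in> vector_fields M U"
  unfolding vector_fields_def
  by (auto simp: along_def openin_in_topspace[OF U]
      intro: tangent_zero[OF M] smooth_functions_const_on[OF M])

lemma vector_fields_sum:
  assumes M: "smooth_manifold M" and U: "openin (mtop M) U" and "finite I"
    and "\<And>i. i \<in> I \<Longrightarrow> u i \<in> smooth_functions M U" and "\<And>i. i \<in> I \<Longrightarrow> X i \<in> vector_fields M U"
  shows "(\<Sum>i\<in>I. u i \<odot> X i) \<in> vector_fields M U"
  using assms(3-)
  by (induction I rule: finite_induct)
     (simp_all add: vector_fields_zero[OF M U] vector_fields_add[OF M U] vector_fields_fscale[OF M U])

text \<open>In its own chart the field differentiates by a partial derivative, which preserves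
  smoothness; one chart is enough by \<open>smooth_functions_one_chart\<close>.\<close>

lemma coord_field_vector_field:
  assumes M: "smooth_manifold M" and c: "(V, \<phi>) \<in> atlas M"
  shows "coord_field M (V, \<phi>) i \<in> vector_fields M V"
  unfolding vector_fields_def
proof (intro CollectI conjI ballI allI impI)
  fix q assume "q \<in> V"
  then show "coord_field M (V, \<phi>) i q \<in> tangent_space M q"
    unfolding tangent_space_chart[OF M c \<open>q \<in> V\<close>] by (simp add: coord_field.simps)
next
  fix W f assume W: "openin (mtop M) W" "W \<subseteq> V" and f: "f \<in> smooth_functions M W"
  have VW: "V \<inter> W = W" using W by blast
  have S: "open (\<phi> ` W)" using chart_open_image[OF M c W(1)] VW by simp
  have "smooth_on (f \<circ> inv_into V \<phi>) (\<phi> ` W)" using smooth_functionsD[OF f c] VW by simp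
  then have "smooth_on (\<lambda>x. frechet_derivative (f \<circ> inv_into V \<phi>) (at x) (axis i 1)) (\<phi> ` W)"
    by (rule smooth_on_derivative)
  then have "smooth_on (along (coord_field M (V, \<phi>) i) f \<circ> inv_into V \<phi>) (\<phi> ` W)"
  proof (rule smooth_on_cong[OF S, rotated])
    fix y assume "y \<in> \<phi> ` W"
    then obtain q where q: "q \<in> W" "q \<in> V" "y = \<phi> q" using W(2) by blast
    have "smooth_near M q f" unfolding smooth_near_def using W(1) q(1) f by blast
    then show "frechet_derivative (f \<circ> inv_into V \<phi>) (at y) (axis i 1)
        = (along (coord_field M (V, \<phi>) i) f \<circ> inv_into V \<phi>) y"
      using q(2) by (simp add: q(3) chart_inv[OF M c] along_def coord_field.simps chart_vec.simps)
  qed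
  then show "along (coord_field M (V, \<phi>) i) f \<in> smooth_functions M W"
    by (rule smooth_functions_one_chart[OF M c W])
qed

section \<open>Function-linearity and locality of a connection in its first argument\<close>

lemma connection_closed:
  assumes "affine_connection M nabla" and "openin (mtop M) U"
    and "X \<in> vector_fields M U" and "Y \<in> vector_fields M U"
  shows "nabla X Y \<in> vector_fields M U"
  using assms(1)[unfolded affine_connection_def, THEN spec, THEN mp, OF assms(2), THEN conjunct1] assms(3,4)
  by blast

lemma
  assumes M: "smooth_manifold M" and nabla: "affine_connection M nabla"
    and W: "openin (mtop M) W" "p \<in> W" and X: "X \<in> vector_fields M W" and Z: "Z \<in> vector_fields M W"
  shows connection_add_left: "Y \<in> vector_fields M W \<Longrightarrow> nabla (X + Y) Z p = nabla X Z p + nabla Y Z p"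
    and connection_fscale_left: "f \<in> smooth_functions M W \<Longrightarrow> nabla (f \<odot> X) Z p = vscale (f p) (nabla X Z p)"
proof -
  note linear = nabla[unfolded affine_connection_def, THEN spec, THEN mp, OF W(1), THEN conjunct2,
      rule_format, OF X _ Z _ W(2)]
  \<comment> \<open>The connection laws are bundled under a common smooth function \<open>f\<close>;
    to extract additivity, some \<open>f\<close> has to be supplied.\<close>
  have zero: "0 \<in> smooth_functions M W" by (rule smooth_functions_const_on[OF M W(1)]) simp
  show "nabla (X + Y) Z p = nabla X Z p + nabla Y Z p" if "Y \<in> vector_fields M W"
    using linear[OF that zero] by blast
  show "nabla (f \<odot> X) Z p = vscale (f p) (nabla X Z p)" if "f \<in> smooth_functions M W"
    using linear[OF X that] by (simp add: fscale_def)
qed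

lemma connection_sum_left:
  assumes M: "smooth_manifold M" and nabla: "affine_connection M nabla"
    and W: "openin (mtop M) W" "p \<in> W" and Z: "Z \<in> vector_fields M W" and "finite I"
    and "\<And>i. i \<in> I \<Longrightarrow> u i \<in> smooth_functions M W" and "\<And>i. i \<in> I \<Longrightarrow> X i \<in> vector_fields M W"
  shows "nabla (\<Sum>i\<in>I. u i \<odot> X i) Z p = (\<Sum>i\<in>I. vscale (u i p) (nabla (X i) Z p))"
  using assms(6-)
proof (induction I rule: finite_induct)
  case empty
  \<comment> \<open>Writing the zero field as a zero multiple makes homogeneity force the value
    0.\<close>
  have "nabla (0 \<odot> 0) Z p = vscale ((0 :: 'a \<Rightarrow> real) p) (nabla 0 Z p)"
    by (rule connection_fscale_left[OF M nabla W vector_fields_zero[OF M W(1)] Z])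
       (rule smooth_functions_const_on[OF M W(1)], simp)
  then show ?case unfolding sum.empty fscale_zero zero_fun_apply vscale_zero .
next
  case (insert i I)
  then show ?case
    unfolding sum.insert[OF insert.hyps]
    by (subst connection_add_left[OF M nabla W _ Z])
       (simp_all add: connection_fscale_left[OF M nabla W _ Z]
        vector_fields_fscale[OF M W(1)] vector_fields_sum[OF M W(1)])
qed

text \<open>The fields may differ off \<open>W\<close>; multiplying by the indicator of \<open>W\<close>, which is smooth on \<open>W\<close>,
  makes them equal as total functions.\<close>

lemma connection_local_left:
  assumes M: "smooth_manifold M" and nabla: "affine_connection M nabla"
    and W: "openin (mtop M) W" "p \<in> W" and Z: "Z \<in> vector_fields M W"
    and X: "X \<in> vector_fields M W" "Y \<in> vector_fields M W" and eq: "\<And>q. q \<in> W \<Longrightarrow> X q = Y q"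
  shows "nabla X Z p = nabla Y Z p"
proof -
  let ?\<chi> = "\<lambda>q. if q \<in> W then 1 else 0 :: real"
  have \<chi>: "?\<chi> \<in> smooth_functions M W"
    by (rule smooth_functions_const_on[OF M W(1), where a = 1]) simp
  have "?\<chi> \<odot> X = ?\<chi> \<odot> Y"
    by (auto simp: fscale_def vscale_def fun_eq_iff eq)
  then show ?thesis
    using connection_fscale_left[OF M nabla W X(1) Z \<chi>] connection_fscale_left[OF M nabla W X(2) Z \<chi>] W(2)
    by (simp add: vscale_def)
qed

text \<open>On \<open>U \<inter> V\<close> the field \<open>X\<close> is a smooth combination of
  coordinate fields; locality and function-linearity move the combination out of
  \<open>nabla\<close>. Thus the value at \<open>p\<close> depends on \<open>X\<close> only through
  \<open>X p\<close>.\<close>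

lemma connection_expansion:
  fixes M :: "('m, 'n::finite) manifold"
  assumes M: "smooth_manifold M" and nabla: "affine_connection M nabla"
    and U: "openin (mtop M) U" "p \<in> U" and X: "X \<in> vector_fields M U" and Z: "Z \<in> vector_fields M U"
    and c: "(V, \<phi>) \<in> atlas M" "p \<in> V"
  shows "nabla X Z p = (\<Sum>i\<in>UNIV. vscale (X p (\<lambda>q. \<phi> q $ i)) (nabla (coord_field M (V, \<phi>) i) Z p))"
proof -
  define W where "W = U \<inter> V"
  have W: "openin (mtop M) W" "p \<in> W" and sub: "W \<subseteq> U" "W \<subseteq> V"
    using U c chart_openin[OF M c(1)] by (auto simp: W_def)
  let ?u = "\<lambda>i. along X (\<lambda>q. \<phi> q $ i)" and ?B = "coord_field M (V, \<phi>)"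
  have X': "X \<in> vector_fields M W" and Z': "Z \<in> vector_fields M W"
    using X Z sub vector_fields_subset by blast+
  \<comment> \<open>The components are \<open>X\<close> applied to the coordinate functions, so they
    are smooth by the definition of a smooth field.\<close>
  have u: "?u i \<in> smooth_functions M W" for i
    by (rule vector_fields_along[OF X' W(1) order.refl])
       (rule smooth_functions_subset[OF coordinate_function_smooth[OF M c(1)] sub(2)])
  have B: "?B i \<in> vector_fields M W" for i
    by (rule vector_fields_subset[OF coord_field_vector_field[OF M c(1)] sub(2)])
  have "X q = (\<Sum>i\<in>UNIV. ?u i \<odot> ?B i) q" if "q \<in> W" for q
  proof -
    have "X q = (\<Sum>i\<in>UNIV. vscale (X q (\<lambda>q. \<phi> q $ i)) (?B i q))"
      by (rule tangent_expansion[OF M c(1) _ vector_fields_tangent[OF X' that]]) (use that sub in blast)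
    then show ?thesis
      unfolding sum_fscale_apply along_def .
  qed
  then have "nabla X Z p = nabla (\<Sum>i\<in>UNIV. ?u i \<odot> ?B i) Z p"
    by (rule connection_local_left[OF M nabla W Z' X' vector_fields_sum[OF M W(1) finite u B]])
  also have "\<dots> = (\<Sum>i\<in>UNIV. vscale (?u i p) (nabla (?B i) Z p))"
    by (rule connection_sum_left[OF M nabla W Z' finite u B])
  finally show ?thesis by (simp only: along_def)
qed


section \<open>Tensoriality and traces\<close>

lemma D2_apply:
  "D2 A nabla \<pi> X Z p = X p (form_app \<pi> Z) - \<pi> p (nabla X Z p) + \<pi> p (Z p) * \<pi> p (A p (X p))"
  by (simp add: D2_def cov_deriv_form_def form_app_def endo_app_def along_def)

text \<open>The summand with \<open>nabla X Z\<close> is handled by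
  \<open>connection_expansion\<close>; the other two depend linearly on the vector
  \<open>X p\<close>. This expresses tensoriality in the first slot, although \<open>D2\<close> acts
  on fields.\<close>

lemma D2_expansion:
  fixes M :: "('m, 'n::finite) manifold"
  assumes M: "smooth_manifold M" and nabla: "affine_connection M nabla"
    and A: "endo_field M A" and \<pi>: "one_form M \<pi>"
    and U: "openin (mtop M) U" "p \<in> U" and X: "X \<in> vector_fields M U" and Z: "Z \<in> vector_fields M U"
    and c: "(V, \<phi>) \<in> atlas M" "p \<in> V"
  shows "D2 A nabla \<pi> X Z p
       = (\<Sum>i\<in>UNIV. X p (\<lambda>q. \<phi> q $ i) * D2 A nabla \<pi> (coord_field M (V, \<phi>) i) Z p)"
proof -
  let ?B = "coord_field M (V, \<phi>)" and ?x = "\<lambda>i q. \<phi> q $ i"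
  have p: "p \<in> topspace (mtop M)" by (rule openin_in_topspace[OF U])
  have B: "?B i p \<in> tangent_space M p" for i
    by (rule vector_fields_tangent[OF coord_field_vector_field[OF M c(1)] c(2)])
  \<comment> \<open>\<open>Z\<close> lives on \<open>U\<close> and the frame on \<open>V\<close>, so
    closure of the connection is applied on the intersection.\<close>
  have W: "openin (mtop M) (U \<inter> V)" using U(1) chart_openin[OF M c(1)] by blast
  have "nabla (?B i) Z \<in> vector_fields M (U \<inter> V)" for i
    by (rule connection_closed[OF nabla W])
       (auto intro: vector_fields_subset[OF coord_field_vector_field[OF M c(1)]] vector_fields_subset[OF Z])
  then have nB: "nabla (?B i) Z p \<in> tangent_space M p" for i
    by (rule vector_fields_tangent) (use U c in blast)
  have \<pi>_lin: "\<pi> p (u + v) = \<pi> p u + \<pi> p v" "\<pi> p (vscale a u) = a * \<pi> p u"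
    if "u \<in> tangent_space M p" "v \<in> tangent_space M p" for u v a
    using \<pi> p that unfolding one_form_def by blast+
  have A_lin: "A p u \<in> tangent_space M p" "A p (u + v) = A p u + A p v" "A p (vscale a u) = vscale a (A p u)"
    if "u \<in> tangent_space M p" "v \<in> tangent_space M p" for u v a
    using A p that unfolding endo_field_def by blast+
  have "\<pi> p (nabla X Z p) = (\<Sum>i\<in>UNIV. X p (?x i) * \<pi> p (nabla (?B i) Z p))"
    unfolding connection_expansion[OF M nabla U X Z c]
    by (rule tangent_functional_sum[OF M p finite nB]) (use \<pi>_lin in blast)+
  moreover
  \<comment> \<open>With \<open>Z\<close> fixed, \<open>L\<close> gathers the two summands that are
    linear in the tangent vector; the derivative of \<open>form_app \<pi> Z\<close> is linear
    because vectors are added and scaled pointwise as operators.\<close>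
  define L where "L = (\<lambda>v. v (form_app \<pi> Z) + \<pi> p (Z p) * \<pi> p (A p v))"
  have "L (\<Sum>i\<in>UNIV. vscale (X p (?x i)) (?B i p)) = (\<Sum>i\<in>UNIV. X p (?x i) * L (?B i p))"
  proof (rule tangent_functional_sum[OF M p finite B])
    fix u v assume uv: "u \<in> tangent_space M p" "v \<in> tangent_space M p"
    show "L (u + v) = L u + L v"
      unfolding L_def A_lin(2)[OF uv] \<pi>_lin(1)[OF A_lin(1)[OF uv] A_lin(1)[OF uv(2,1)]]
      by (simp add: algebra_simps)
  next
    fix u a assume u: "u \<in> tangent_space M p"
    show "L (vscale a u) = a * L u"
      unfolding L_def A_lin(3)[OF u u] \<pi>_lin(2)[OF A_lin(1)[OF u u] u]
      by (simp add: algebra_simps vscale_def)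
  qed
  then have "L (X p) = (\<Sum>i\<in>UNIV. X p (?x i) * L (?B i p))"
    using tangent_expansion[OF M c vector_fields_tangent[OF X U(2)]] by simp
  ultimately show ?thesis
    unfolding D2_apply L_def
    by (simp add: sum_subtractf sum.distrib algebra_simps)
qed

text \<open>With \<open>G\<close> and \<open>J\<close> the matrices of \<open>g\<close> and \<open>A\<close> in a coordinate frame, \<open>A\<close> is skew for \<open>g\<close>, that is
  \<open>G J = - J\<^sup>T G\<close>; multiplying by the inverse of \<open>G\<close> and taking traces gives \<open>tr J = - tr J\<close>.\<close>

lemma almost_complex_trace_zero:
  fixes M :: "('m, 'n::finite) manifold"
  assumes M: "smooth_manifold M" and g: "riemannian_metric M g" and A: "endo_field M A"
    and c: "(V, \<phi>) \<in> atlas M" "p \<in> V"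
    and AA: "\<And>u. u \<in> tangent_space M p \<Longrightarrow> A p (A p u) = - u"
    and gA: "\<And>u v. u \<in> tangent_space M p \<Longrightarrow> v \<in> tangent_space M p \<Longrightarrow> g p (A p u) (A p v) = g p u v"
  shows "(\<Sum>i\<in>UNIV. A p (coord_field M (V, \<phi>) i p) (\<lambda>q. \<phi> q $ i)) = 0"
proof -
  let ?T = "tangent_space M p"
  define b where "b i = coord_field M (V, \<phi>) i p" for i
  have p: "p \<in> topspace (mtop M)"
    by (rule openin_in_topspace[OF chart_openin[OF M c(1)] c(2)])
  have b: "b i \<in> ?T" for i
    unfolding b_def by (rule vector_fields_tangent[OF coord_field_vector_field[OF M c(1)] c(2)])
  have Ab: "A p (b i) \<in> ?T" for i
    using A p b unfolding endo_field_def by blast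
  have expand: "v = (\<Sum>i\<in>UNIV. vscale (v (\<lambda>q. \<phi> q $ i)) (b i))" if "v \<in> ?T" for v
    unfolding b_def by (rule tangent_expansion[OF M c that])
  have g_props: "g p u v = g p v u" "g p (u + v) w = g p u w + g p v w" "g p (vscale a u) w = a * g p u w"
      "u \<noteq> 0 \<Longrightarrow> g p u u > 0"
    if "u \<in> ?T" "v \<in> ?T" "w \<in> ?T" for u v w a
    using g p that unfolding riemannian_metric_def by blast+
  have g_sum: "g p (\<Sum>i\<in>UNIV. vscale (a i) (b i)) w = (\<Sum>i\<in>UNIV. a i * g p (b i) w)" if "w \<in> ?T" for a w
    by (rule tangent_functional_sum[OF M p finite b]) (use g_props that in blast)+
  define G :: "real^'n^'n" where "G = (\<chi> i j. g p (b i) (b j))"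
  define J :: "real^'n^'n" where "J = (\<chi> i j. A p (b j) (\<lambda>q. \<phi> q $ i))"
  have g_A: "g p (A p (b j)) (b k) = (\<Sum>i\<in>UNIV. J $ i $ j * g p (b i) (b k))" for j k
    using g_sum[OF b, of "\<lambda>i. J $ i $ j" k] expand[OF Ab[of j]] by (simp add: J_def)
  \<comment> \<open>Applying \<open>A\<close> to both arguments preserves \<open>g\<close> and turns
    \<open>A p (b k)\<close> into \<open>- b k\<close>; the sign is written as
    \<open>vscale (-1)\<close> to use homogeneity of \<open>g\<close>.\<close>
  have skew: "g p (A p (b k)) (b j) = - g p (A p (b j)) (b k)" for j k
  proof -
    have "g p (A p (b k)) (b j) = g p (vscale (-1) (b k)) (A p (b j))"
      using gA[OF Ab b, of k j] AA[OF b[of k]] by (simp add: vscale_def fun_Compl_def)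
    also have "\<dots> = - g p (A p (b j)) (b k)"
      using g_props(3)[OF b Ab Ab] g_props(1)[OF b Ab b] by simp
    finally show ?thesis .
  qed
  have GJ: "G ** J = - (transpose J ** G)"
  proof -
    have "(G ** J) $ k $ j = - (transpose J ** G) $ k $ j" for k j
    proof -
      have "(G ** J) $ k $ j = (\<Sum>i\<in>UNIV. J $ i $ j * g p (b i) (b k))"
        unfolding matrix_matrix_mult_def using g_props(1)[OF b b b] by (simp add: G_def mult.commute)
      also have "\<dots> = - (\<Sum>i\<in>UNIV. J $ i $ k * g p (b i) (b j))"
        using skew[of j k] by (simp add: g_A)
      finally show ?thesis by (simp add: matrix_matrix_mult_def transpose_def G_def)
    qed
    then show ?thesis by (simp add: vec_eq_iff)
  qed
  \<comment> \<open>Invertibility of \<open>G\<close> comes from positive definiteness: if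
    \<open>h\<close> is in the kernel, the vector \<open>v\<close> with components \<open>h\<close>
    satisfies \<open>g p v v = 0\<close>.\<close>
  have "h = 0" if "G *v h = 0" for h
  proof (rule ccontr)
    assume "h \<noteq> 0"
    define v where "v = (\<Sum>i\<in>UNIV. vscale (h $ i) (b i))"
    have vT: "v \<in> ?T" unfolding v_def by (rule tangent_sum[OF M p finite b])
    \<comment> \<open>As a chart vector, \<open>v\<close> gives its components back, so a nonzero
      \<open>h\<close> forces a nonzero \<open>v\<close>.\<close>
    have "v = chart_vec M (V, \<phi>) p (\<Sum>i\<in>UNIV. h $ i *\<^sub>R axis i 1)"
      unfolding chart_vec_sum[OF c finite] v_def b_def using c(2) by (simp add: coord_field.simps)
    then have v_coord: "v (\<lambda>q. \<phi> q $ i) = h $ i" for i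
      using basis_expansion[of h] by (simp add: chart_vec_coordinate[OF M c] scalar_mult_eq_scaleR)
    have "v \<noteq> 0" using v_coord \<open>h \<noteq> 0\<close> by (auto simp: vec_eq_iff)
    then have "g p v v > 0" using g_props(4) vT by blast
    moreover have "g p (b i) v = (G *v h) $ i" for i
    proof -
      have "g p (b i) v = g p v (b i)" using g_props(1) b vT by blast
      also have "\<dots> = (\<Sum>j\<in>UNIV. h $ j * g p (b i) (b j))"
        unfolding v_def g_sum[OF b] using g_props(1)[OF b b b] by simp
      finally show ?thesis by (simp add: matrix_vector_mult_def G_def mult.commute)
    qed
    then have "g p v v = 0" using that g_sum[OF vT, of "\<lambda>i. h $ i"] by (simp add: v_def[symmetric])
    ultimately show False by simp
  qed
  then obtain P where P: "P ** G = mat 1" using matrix_left_invertible_ker[of G] by blast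
  have "trace J = trace (P ** (G ** J))" by (simp add: P matrix_mul_assoc)
  also have "\<dots> = - trace ((P ** transpose J) ** G)"
    unfolding GJ matrix_mul_assoc[symmetric]
    by (simp add: trace_def matrix_matrix_mult_def[of P] sum_negf)
  \<comment> \<open>Cyclicity of the trace brings \<open>G\<close> next to \<open>P\<close>. A left
    inverse of a square matrix is also a right inverse, and transposition keeps the
    diagonal.\<close>
  also have "trace ((P ** transpose J) ** G) = trace ((G ** P) ** transpose J)"
    by (metis matrix_mul_assoc trace_mul_sym)
  also have "\<dots> = trace J"
    using P matrix_left_right_inverse[of P G] by (simp add: trace_def transpose_def)
  finally show ?thesis by (simp add: trace_def J_def b_def)
qed

section \<open>Comparison of the tensors built from two generators\<close>

lemma R2_apply:
  "R2 M A nabla \<pi> X Y Z p f = curvature M nabla X Y Z p f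
     - D2 A nabla \<pi> X Z p * A p (Y p) f + D2 A nabla \<pi> Y Z p * A p (X p) f"
  by (simp add: R2_def fscale_def vscale_def endo_app_def)

lemma H2_apply:
  "H2 M A nabla \<pi> X Y Z p f = R2 M A nabla \<pi> X Y Z p f
     + Ric2 M A nabla \<pi> (endo_app A X) Z p * A p (Y p) f - Ric2 M A nabla \<pi> (endo_app A Y) Z p * A p (X p) f"
  by (simp add: H2_def fscale_def vscale_def endo_app_def)

text \<open>The argument \<open>endo_app A Y\<close> is the one that occurs in \<open>H2\<close>.
  The curvature cancels summand by summand, and what remains is a contraction of \<open>E\<close>
  with \<open>- A p (A p (Y p))\<close> plus a multiple of the trace of \<open>A\<close>.\<close>

lemma Ric2_diff:
  fixes M :: "('m, 'n::finite) manifold"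
  assumes K: "kahler_manifold M g A nabla" and \<pi>: "one_form M \<pi>" and \<pi>': "one_form M \<pi>'"
    and U: "openin (mtop M) U" "p \<in> U" and Y: "Y \<in> vector_fields M U" and Z: "Z \<in> vector_fields M U"
  shows "Ric2 M A nabla \<pi> (endo_app A Y) Z p - Ric2 M A nabla \<pi>' (endo_app A Y) Z p
       = D2 A nabla \<pi> Y Z p - D2 A nabla \<pi>' Y Z p"
proof -
  have M: "smooth_manifold M" and nabla: "affine_connection M nabla" and A: "endo_field M A"
    and g: "riemannian_metric M g"
    using K by (auto simp: kahler_manifold_def levi_civita_def)
  have p: "p \<in> topspace (mtop M)" by (rule openin_in_topspace[OF U])
  have AA: "A p (A p u) = - u" if "u \<in> tangent_space M p" for u
    using K p that unfolding kahler_manifold_def by blast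
  have gA: "g p (A p u) (A p v) = g p u v" if "u \<in> tangent_space M p" "v \<in> tangent_space M p" for u v
    using K p that unfolding kahler_manifold_def by blast
  obtain V \<phi> where chart: "chart_at M p = (V, \<phi>)" by fastforce
  \<comment> \<open>Since the atlas covers the manifold, the choice in \<open>chart_at\<close>
    really yields a chart around \<open>p\<close>.\<close>
  obtain V' \<psi> where "(V', \<psi>) \<in> atlas M" "p \<in> V'"
    using M p unfolding smooth_manifold_def by blast
  then have "\<exists>c. c \<in> atlas M \<and> p \<in> fst c" by (intro exI[of _ "(V', \<psi>)"]) simp
  then have "chart_at M p \<in> atlas M \<and> p \<in> fst (chart_at M p)"
    unfolding chart_at_def by (rule someI_ex)
  then have c: "(V, \<phi>) \<in> atlas M" "p \<in> V" by (simp_all add: chart)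
  let ?B = "coord_field M (V, \<phi>)" and ?x = "\<lambda>i q. \<phi> q $ i"
  define E where "E X = D2 A nabla \<pi> X Z p - D2 A nabla \<pi>' X Z p" for X
  have E_expand: "E X = (\<Sum>i\<in>UNIV. X p (?x i) * E (?B i))" if "X \<in> vector_fields M U" for X
    unfolding E_def D2_expansion[OF M nabla A \<pi> U that Z c] D2_expansion[OF M nabla A \<pi>' U that Z c]
    by (simp only: sum_subtractf right_diff_distrib)
  have trace: "(\<Sum>i\<in>UNIV. A p (?B i p) (?x i)) = 0"
    by (rule almost_complex_trace_zero[OF M g A c]) (fact AA gA)+
  let ?AY = "endo_app A Y"
  have "Ric2 M A nabla \<pi> ?AY Z p - Ric2 M A nabla \<pi>' ?AY Z p
      = (\<Sum>i\<in>UNIV. - (A p (?AY p) (?x i) * E (?B i)) + E ?AY * A p (?B i p) (?x i))"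
    unfolding Ric2_def trace_field_def Let_def chart R2_apply E_def sum_subtractf[symmetric] snd_conv
    by (intro sum.cong refl) (simp add: algebra_simps)
  \<comment> \<open>The square of \<open>A\<close> cancels the minus sign, leaving the frame
    expansion of \<open>E Y\<close>; the factor \<open>E ?AY\<close> is constant in \<open>i\<close>
    and comes out of the trace.\<close>
  also have "\<dots> = (\<Sum>i\<in>UNIV. Y p (?x i) * E (?B i)) + E ?AY * (\<Sum>i\<in>UNIV. A p (?B i p) (?x i))"
    using AA[OF vector_fields_tangent[OF Y U(2)]]
    by (simp add: sum.distrib sum_distrib_left endo_app_def fun_Compl_def)
  also have "\<dots> = E Y"
    using E_expand[OF Y] trace by simp
  finally show ?thesis by (simp add: E_def)
qed

theorem theorem4p3:
  fixes M :: "('m, 'n::finite) manifold"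
    and g :: "'m bilin" and A :: "'m endo"
    and nabla nabla1 nabla1' :: "'m connection"
    and \<pi> \<pi>' :: "'m form"
    and U :: "'m set" and X Y Z :: "'m vfield" and p :: 'm
  assumes "kahler_manifold M g A nabla"
    and "one_form M \<pi>" and "quarter_symmetric_metric_A_connection M A nabla \<pi> nabla1"
    and "one_form M \<pi>'" and "quarter_symmetric_metric_A_connection M A nabla \<pi>' nabla1'"
    and "openin (mtop M) U"
    and "X \<in> vector_fields M U" and "Y \<in> vector_fields M U" and "Z \<in> vector_fields M U"
    and "p \<in> U"
  shows "H2 M A nabla \<pi> X Y Z p = H2 M A nabla \<pi>' X Y Z p"
proof (rule ext)
  fix f
  note ric = Ric2_diff[OF assms(1,2,4,6,10) _ assms(9)]
  \<comment> \<open>Tangent vectors are operators, so equality is tested on each \<open>f\<close>.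
    Sorting by \<open>A p (Y p) f\<close> and \<open>A p (X p) f\<close> makes each coefficient an
    instance of \<open>Ric2_diff\<close>.\<close>
  have "H2 M A nabla \<pi> X Y Z p f - H2 M A nabla \<pi>' X Y Z p f
      = ((Ric2 M A nabla \<pi> (endo_app A X) Z p - Ric2 M A nabla \<pi>' (endo_app A X) Z p)
          - (D2 A nabla \<pi> X Z p - D2 A nabla \<pi>' X Z p)) * A p (Y p) f
      - ((Ric2 M A nabla \<pi> (endo_app A Y) Z p - Ric2 M A nabla \<pi>' (endo_app A Y) Z p)
          - (D2 A nabla \<pi> Y Z p - D2 A nabla \<pi>' Y Z p)) * A p (X p) f"
    unfolding H2_apply R2_apply by (simp only: algebra_simps)
  also have "\<dots> = 0" unfolding ric[OF assms(7)] ric[OF assms(8)] by simp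
  finally show "H2 M A nabla \<pi> X Y Z p f = H2 M A nabla \<pi>' X Y Z p f" by simp
qed

end
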